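(* For any non-degenerate triangle $ABC$, the surface $\mathrm{FC}=F(\mathrm{Cyl}\cap\Pi^+)$ has positive Gaussian curvature on the set $M_{\mathrm{reg}}$.
   Context: Let $\Pi^0=\{(p,q,0)\}\subset\mathbb{R}^3$ and $\Pi^+=\{(p,q,r)\in\mathbb{R}^3\mid r>0\}$. $ABC$ is a non-degenerate triangle in $\Pi^0$, normalized so that its circumscribed circle $S$ has radius $1$ and center at the origin, with $A=(1,0,0)$, $B=\left(\frac{u^2-1}{u^2+1},\frac{2u}{u^2+1},0\right)$, $C=\left(\frac{v^2-1}{v^2+1},\frac{2v}{v^2+1},0\right)$, where $u\ne v$ are real. $\mathrm{Cyl}=S\times(-\infty,\infty)$. For $D\in\Pi^+$, $F(D)=(\cos\angle BDC,\cos\angle ADC,\cos\angle ADB)$. The surface $\mathrm{FC}$ is regarded as the parametrized surface $(\theta,r)\mapsto F(\cos\theta,\sin\theta,r)$, $r>0$. $M_{\mathrm{reg}}=\{(\cos\theta,\sin\theta,r)\mid\theta\in[0,2\pi)\setminus\{\theta_1,\theta_2,\theta_3\},\ r\in(0,\infty)\}$, where $\theta_1,\theta_2,\theta_3\in[0,2\pi)$ are the three distinct angles for which $t=\tan(\theta/2)$ satisfies $$(u+v)t^3+3(uv-1)t^2-3(u+v)t-uv+1=0,$$ with $\theta=\pi$ (i.e. $t=\infty$) counted as one of the three solutions exactly when $u+v=0$. At the points of $M_{\mathrm{reg}}$ the partial derivatives of the parametrization are linearly independent. "Positive Gaussian curvature on $M_{\mathrm{reg}}$" means that the Gaussian curvature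 of the parametrized surface is positive at each parameter point corresponding to a point of $M_{\mathrm{reg}}$. *)

theory Defs
  imports "HOL-Analysis.Analysis"
begin

text \<open>The angle \<open>\<angle>PQR\<close> at the vertex \<open>Q\<close>; used only for \<open>P \<noteq> Q \<noteq> R\<close>.\<close>

definition angle :: "real^3 \<Rightarrow> real^3 \<Rightarrow> real^3 \<Rightarrow> real" where
  "angle P Q R = arccos (((P - Q) \<bullet> (R - Q)) / (norm (P - Q) * norm (R - Q)))"

definition F :: "real^3 \<Rightarrow> real^3 \<Rightarrow> real^3 \<Rightarrow> real^3 \<Rightarrow> real^3" where
  "F A B C D = vector [cos (angle B D C), cos (angle A D C), cos (angle A D B)]"

definition cyl_point :: "real \<Rightarrow> real \<Rightarrow> real^3" where
  "cyl_point \<theta> r = vector [cos \<theta>, sin \<theta>, r]"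

definition FC :: "real^3 \<Rightarrow> real^3 \<Rightarrow> real^3 \<Rightarrow> real \<Rightarrow> real \<Rightarrow> real^3" where
  "FC A B C \<theta> r = F A B C (cyl_point \<theta> r)"

text \<open>The value \<open>\<theta> = \<pi>\<close> corresponds to \<open>tan (\<theta>/2) = \<infinity>\<close>, a root of the cubic exactly when its
  leading coefficient vanishes. It is treated separately because \<open>tan (\<pi>/2) = 0\<close> in HOL.\<close>

definition singular_angles :: "real \<Rightarrow> real \<Rightarrow> real set" where
  "singular_angles u v = {\<theta> \<in> {0..<2*pi}.
     if \<theta> = pi then u + v = 0
     else let t = tan (\<theta>/2)
          in (u + v) * t^3 + 3 * (u * v - 1) * t^2 - 3 * (u + v) * t - u * v + 1 = 0}"

definition M_reg :: "real \<Rightarrow> real \<Rightarrow> (real^3) set" where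
  "M_reg u v = {cyl_point \<theta> r | \<theta> r. \<theta> \<in> {0..<2*pi} - singular_angles u v \<and> r > 0}"

definition partial1 :: "(real \<Rightarrow> real \<Rightarrow> real^3) \<Rightarrow> real \<Rightarrow> real \<Rightarrow> real^3" where
  "partial1 X s t = vector_derivative (\<lambda>s'. X s' t) (at s)"

definition partial2 :: "(real \<Rightarrow> real \<Rightarrow> real^3) \<Rightarrow> real \<Rightarrow> real \<Rightarrow> real^3" where
  "partial2 X s t = vector_derivative (\<lambda>t'. X s t') (at t)"

definition unit_normal :: "(real \<Rightarrow> real \<Rightarrow> real^3) \<Rightarrow> real \<Rightarrow> real \<Rightarrow> real^3" where
  "unit_normal X s t = sgn (cross3 (partial1 X s t) (partial2 X s t))"

text \<open>The determinant of the second fundamental form divided by that of the first. Where the first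
  partial derivatives are linearly dependent, the value is \<open>0\<close>.\<close>

definition gaussian_curvature :: "(real \<Rightarrow> real \<Rightarrow> real^3) \<Rightarrow> real \<Rightarrow> real \<Rightarrow> real" where
  "gaussian_curvature X s t =
    (let n = unit_normal X s t;
         e = partial1 X s t \<bullet> partial1 X s t;
         f = partial1 X s t \<bullet> partial2 X s t;
         g = partial2 X s t \<bullet> partial2 X s t;
         l = partial1 (partial1 X) s t \<bullet> n;
         m = partial2 (partial1 X) s t \<bullet> n;
         k = partial2 (partial2 X) s t \<bullet> n
     in (l * k - m^2) / (e * g - f^2))"

end

theory Submission
  imports Defs
begin

text \<open>
  The differential of \<open>F\<close> is singular exactly along the cylinder, and the covector annihilating its
  image is a normal of \<open>FC\<close>. With \<open>A = (cos 2a, sin 2a, 0)\<close> and likewise \<open>b\<close>, \<open>c\<close>, it is, up to a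
  factor, \<open>n = (cos (\<theta>/2 - a) / (sin (b - c) |DA|), \<dots>)\<close>. Differentiating \<open>X\<^sub>\<theta> \<bullet> n = X\<^sub>r \<bullet> n = 0\<close>
  expresses the second fundamental form through first derivatives of \<open>X\<close> and \<open>n\<close>. The mixed
  coefficient vanishes, and the two diagonal ones are positive multiples of one and the same number,
  \<open>sin (b - a) sin (c - b) sin (a - c) cos (3\<theta>/2 - a - b - c)\<close>, whose last factor is the cubic in
  \<open>tan (\<theta>/2)\<close> up to a nonzero factor.
\<close>

section \<open>Gaussian curvature from an unnormalized normal field\<close>

lemma vector_3_has_vector_derivative:
  fixes f g h :: "real \<Rightarrow> real"
  assumes "(f has_real_derivative f') (at x)" "(g has_real_derivative g') (at x)"
    "(h has_real_derivative h') (at x)"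
  shows "((\<lambda>x. vector [f x, g x, h x] :: real^3) has_vector_derivative vector [f', g', h']) (at x)"
proof -
  have vec: "(vector [p, q, w] :: real^3) = p *\<^sub>R axis 1 1 + q *\<^sub>R axis 2 1 + w *\<^sub>R axis 3 1"
    for p q w :: real
    by (simp add: vec_eq_iff forall_3 axis_def)
  show ?thesis
    unfolding vec
    using assms by (auto intro!: derivative_eq_intros simp: has_real_derivative_iff_has_vector_derivative)
qed

lemma inner_vector_3: "(vector [a, b, c] :: real^3) \<bullet> vector [x, y, z] = a * x + b * y + c * z"
  by (simp add: inner_vec_def sum_3)

text \<open>Differentiating \<open>Xs\<close> . \<open>n\<close> = 0 and \<open>Xt\<close> .
  \<open>n\<close> = 0 moves one derivative from \<open>X\<close> onto \<open>n\<close>, so the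
  second fundamental form needs no second derivative of \<open>X\<close> beyond its existence. The
  field \<open>n\<close> may have any length, because its factor against the unit normal enters the
  determinant squared. The set \<open>T\<close> restricts only the second parameter, which will be
  the height.\<close>

lemma gaussian_curvature_pos_of_conormal:
  fixes X Xs Xt n :: "real \<Rightarrow> real \<Rightarrow> real^3" and Xss Xst Xtt ns nt :: "real^3"
  assumes T: "open T" "t \<in> T"
    and Xs: "\<And>s t. t \<in> T \<Longrightarrow> ((\<lambda>s'. X s' t) has_vector_derivative Xs s t) (at s)"
    and Xt: "\<And>s t. t \<in> T \<Longrightarrow> ((\<lambda>t'. X s t') has_vector_derivative Xt s t) (at t)"
    and Xss: "((\<lambda>s'. Xs s' t) has_vector_derivative Xss) (at s)"
    and Xst: "((\<lambda>t'. Xs s t') has_vector_derivative Xst) (at t)"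
    and Xtt: "((\<lambda>t'. Xt s t') has_vector_derivative Xtt) (at t)"
    and ns: "((\<lambda>s'. n s' t) has_vector_derivative ns) (at s)"
    and nt: "((\<lambda>t'. n s t') has_vector_derivative nt) (at t)"
    and Xs_n: "\<And>s t. t \<in> T \<Longrightarrow> Xs s t \<bullet> n s t = 0"
    and Xt_n: "\<And>s t. t \<in> T \<Longrightarrow> Xt s t \<bullet> n s t = 0"
    and conj: "Xs s t \<bullet> nt = 0"
    and pos: "(Xs s t \<bullet> ns) * (Xt s t \<bullet> nt) > 0"
  shows "gaussian_curvature X s t > 0"
proof -
  define N where "N = cross3 (Xs s t) (Xt s t)"
  have p1: "partial1 X s' t' = Xs s' t'" if "t' \<in> T" for s' t'
    unfolding partial1_def by (rule vector_derivative_at[OF Xs[OF that]])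
  have p2: "partial2 X s' t' = Xt s' t'" if "t' \<in> T" for s' t'
    unfolding partial2_def by (rule vector_derivative_at[OF Xt[OF that]])
  have p11: "partial1 (partial1 X) s t = Xss"
    using vector_derivative_at[OF Xss] by (simp add: partial1_def[of "partial1 X"] p1 \<open>t \<in> T\<close>)
  have p12: "partial2 (partial1 X) s t = Xst"
  proof -
    have "((\<lambda>t'. partial1 X s t') has_vector_derivative Xst) (at t)"
      by (rule has_vector_derivative_transform_within_open[OF Xst T]) (simp add: p1)
    thus ?thesis unfolding partial2_def by (rule vector_derivative_at)
  qed
  have p22: "partial2 (partial2 X) s t = Xtt"
  proof -
    have "((\<lambda>t'. partial2 X s t') has_vector_derivative Xtt) (at t)"
      by (rule has_vector_derivative_transform_within_open[OF Xtt T]) (simp add: p2)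
    thus ?thesis unfolding partial2_def[of "partial2 X"] by (rule vector_derivative_at)
  qed
  \<comment> \<open>Product rule for an inner product that vanishes near the point. It is used once
    for each coefficient of the second fundamental form.\<close>
  have zero: "y \<bullet> q + x \<bullet> z = 0"
    if "(f has_vector_derivative y) (at w)" "(h has_vector_derivative z) (at w)"
      "\<And>w'. w' \<in> W \<Longrightarrow> f w' \<bullet> h w' = 0" "open W" "w \<in> W" "f w = x" "h w = q"
    for f h :: "real \<Rightarrow> real^3" and w W x y z q
  proof -
    have "((\<lambda>w. f w \<bullet> h w) has_vector_derivative (f w \<bullet> z + y \<bullet> h w)) (at w)"
      by (rule bounded_bilinear.has_vector_derivative[OF bounded_bilinear_inner that(1,2)])
    moreover have "((\<lambda>w. f w \<bullet> h w) has_vector_derivative 0) (at w)"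
      by (rule has_vector_derivative_transform_within_open[where f = "\<lambda>_. 0", OF _ that(4,5)])
        (auto simp: that(3))
    ultimately have "f w \<bullet> z + y \<bullet> h w = 0"
      by (rule vector_derivative_unique_at)
    thus ?thesis using that(6,7) by simp
  qed
  have L: "Xss \<bullet> n s t = - (Xs s t \<bullet> ns)"
    using zero[OF Xss ns, where W = UNIV, OF _ _ _ refl refl] Xs_n[OF \<open>t \<in> T\<close>] by auto
  have M: "Xst \<bullet> n s t = - (Xs s t \<bullet> nt)"
    using zero[OF Xst nt, where W = T, OF _ T refl refl] Xs_n by auto
  have K: "Xtt \<bullet> n s t = - (Xt s t \<bullet> nt)"
    using zero[OF Xtt nt, where W = T, OF _ T refl refl] Xt_n by auto
  have LK: "(Xss \<bullet> n s t) * (Xtt \<bullet> n s t) - (Xst \<bullet> n s t)^2 > 0"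
    using pos by (simp add: L M K conj)
  hence n0: "n s t \<noteq> 0" by auto
  \<comment> \<open>By the Binet-Cauchy identity this product is (\<open>Xs\<close> .
    \<open>ns\<close>)(\<open>Xt\<close> . \<open>nt\<close>) - (\<open>Xs\<close> .
    \<open>nt\<close>)(\<open>Xt\<close> . \<open>ns\<close>). Its positivity makes the first
    partials independent, so the default value of the curvature does not occur.\<close>
  have "N \<bullet> cross3 (ns) (nt) > 0"
    using pos by (simp add: N_def dot_cross conj)
  hence N0: "N \<noteq> 0" by auto
  have "cross3 (n s t) N = 0"
    using Xs_n[OF \<open>t \<in> T\<close>] Xt_n[OF \<open>t \<in> T\<close>]
    by (simp add: N_def Lagrange inner_commute)
  \<comment> \<open>A second cross product with \<open>n\<close> turns parallelism into an explicit
    proportionality between \<open>N\<close> and \<open>n\<close>.\<close>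
  hence "cross3 (n s t) (cross3 (n s t) N) = 0" by (simp only: cross_zero_right)
  hence eq: "(n s t \<bullet> n s t) *\<^sub>R N = (n s t \<bullet> N) *\<^sub>R n s t"
    by (simp add: Lagrange)
  have "N = inverse (n s t \<bullet> n s t) *\<^sub>R ((n s t \<bullet> n s t) *\<^sub>R N)"
    using n0 by simp
  also have "\<dots> = (inverse (n s t \<bullet> n s t) * (n s t \<bullet> N)) *\<^sub>R n s t"
    unfolding eq by (rule scaleR_scaleR)
  finally obtain c where c: "N = c *\<^sub>R n s t" by blast
  then obtain k where k: "sgn N = k *\<^sub>R n s t"
    unfolding sgn_div_norm by (metis scaleR_scaleR)
  have k0: "k \<noteq> 0"
    using k N0 by (auto simp: sgn_zero_iff)
  have "(norm N)^2 = (Xs s t \<bullet> Xs s t) * (Xt s t \<bullet> Xt s t) - (Xs s t \<bullet> Xt s t)^2"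
    by (simp add: N_def norm_cross flip: power2_norm_eq_inner)
  moreover have "unit_normal X s t = k *\<^sub>R n s t"
    by (simp add: unit_normal_def p1 p2 \<open>t \<in> T\<close> k flip: N_def)
  ultimately have "gaussian_curvature X s t =
    k^2 * ((Xss \<bullet> n s t) * (Xtt \<bullet> n s t) - (Xst \<bullet> n s t)^2) / (norm N)^2"
    by (simp add: gaussian_curvature_def Let_def p1 p2 \<open>t \<in> T\<close> p11 p12 p22
        algebra_simps power2_eq_square)
  also have "\<dots> > 0"
    using LK k0 N0 by simp
  finally show ?thesis .
qed

section \<open>Cosines of the apex angles and their derivatives\<close>

text \<open>Angles on the unit circle are recorded by their halves: the point with half angle \<open>p\<close> is
  \<open>(cos 2p, sin 2p, 0)\<close>, and its distance to \<open>cyl_point t r\<close> is \<open>edge_length p t r\<close>.\<close>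

definition edge_length :: "real \<Rightarrow> real \<Rightarrow> real \<Rightarrow> real" where
  "edge_length p t r = sqrt (r^2 + 4 * (sin (t/2 - p))^2)"

definition cos_at_apex :: "real \<Rightarrow> real \<Rightarrow> real \<Rightarrow> real \<Rightarrow> real" where
  "cos_at_apex p q t r = (r^2 + 4 * sin (t/2 - p) * sin (t/2 - q) * cos (p - q))
     / (edge_length p t r * edge_length q t r)"

text \<open>The derivative of \<open>cos_at_apex\<close> in \<open>t\<close>, factored so that sin
  (p - q) cancels the constant of the opposite \<open>conormal\<close> component and the two squared
  lengths appear separated, ready to telescope.\<close>

definition cos_at_apex_t :: "real \<Rightarrow> real \<Rightarrow> real \<Rightarrow> real \<Rightarrow> real" where
  "cos_at_apex_t p q t r = 2 * r^2 * sin (p - q) * cos (t/2 - p) * cos (t/2 - q)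
     * (1 / (edge_length p t r)^2 - 1 / (edge_length q t r)^2)
     / (edge_length p t r * edge_length q t r)"

definition cos_at_apex_r :: "real \<Rightarrow> real \<Rightarrow> real \<Rightarrow> real \<Rightarrow> real" where
  "cos_at_apex_r p q t r = 4 * r * sin (p - q)
     * (sin (t/2 - q) * cos (t/2 - p) / (edge_length q t r)^2
        - sin (t/2 - p) * cos (t/2 - q) / (edge_length p t r)^2)
     / (edge_length p t r * edge_length q t r)"

lemma edge_length_pos: "r \<noteq> 0 \<Longrightarrow> edge_length p t r > 0"
  by (simp add: edge_length_def add_pos_nonneg)

lemma edge_length_squared: "(edge_length p t r)^2 = r^2 + 4 * (sin (t/2 - p))^2"
  by (simp add: edge_length_def)

lemma edge_length_deriv_t:
  assumes "r \<noteq> 0"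
  shows "((\<lambda>t. edge_length p t r) has_real_derivative
           2 * sin (t/2 - p) * cos (t/2 - p) / edge_length p t r) (at t)"
  using edge_length_pos[OF assms, of p t] unfolding edge_length_def
  by (auto intro!: derivative_eq_intros simp: field_simps)

lemma edge_length_deriv_r:
  assumes "r \<noteq> 0"
  shows "((\<lambda>r. edge_length p t r) has_real_derivative r / edge_length p t r) (at r)"
  using edge_length_pos[OF assms, of p t] unfolding edge_length_def
  by (auto intro!: derivative_eq_intros simp: field_simps)

text \<open>With x = t/2, the angle p - q is eliminated in favour of the shifted angles, and the
  derivative identities become polynomial identities modulo sin^2 + cos^2 = 1.\<close>

lemma sin_diff_half: "sin (p - q) = sin (x - q) * cos (x - p) - cos (x - q) * sin (x - p)"
  for p q x :: real
  using sin_diff[of "x - q" "x - p"] by simp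

lemma cos_diff_half: "cos (p - q) = cos (x - q) * cos (x - p) + sin (x - q) * sin (x - p)"
  for p q x :: real
  using cos_diff[of "x - q" "x - p"] by simp

lemma cos_at_apex_deriv_t:
  assumes "r \<noteq> 0"
  shows "((\<lambda>t. cos_at_apex p q t r) has_real_derivative cos_at_apex_t p q t r) (at t)"
proof -
  define Sp Cp Sq Cq sp sq where d: "Sp = sin (t/2 - p)" "Cp = cos (t/2 - p)"
    "Sq = sin (t/2 - q)" "Cq = cos (t/2 - q)" "sp = edge_length p t r" "sq = edge_length q t r"
  have pos: "sp > 0" "sq > 0"
    using edge_length_pos[OF assms] by (simp_all add: d)
  have sq: "sp^2 = r^2 + 4 * Sp^2" "sq^2 = r^2 + 4 * Sq^2" "Sp^2 + Cp^2 = 1" "Sq^2 + Cq^2 = 1"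
    by (simp_all add: d edge_length_squared)
  have cs: "cos (p - q) = Cq * Cp + Sq * Sp" "sin (p - q) = Sq * Cp - Cq * Sp"
    unfolding d by (rule cos_diff_half sin_diff_half)+
  \<comment> \<open>The numerator of the quotient rule with both lengths cleared. Its first
    coefficient is the derivative of 4 sin (t/2 - p) sin (t/2 - q).\<close>
  have "2 * (Cp * Sq + Sp * Cq) * cos (p - q) * sp^2 * sq^2
      - (r^2 + 4 * Sp * Sq * cos (p - q)) * (2 * Sp * Cp * sq^2 + 2 * Sq * Cq * sp^2)
      = 2 * r^2 * sin (p - q) * Cp * Cq * (sq^2 - sp^2)"
    using sq(3,4) unfolding sq(1,2) cs by algebra
  hence "((2 * (Cp * Sq + Sp * Cq) * cos (p - q)) * (sp * sq)
      - (r^2 + 4 * Sp * Sq * cos (p - q)) * (2 * Sp * Cp / sp * sq + sp * (2 * Sq * Cq / sq))) / (sp * sq)^2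
      = 2 * r^2 * sin (p - q) * Cp * Cq * (1 / sp^2 - 1 / sq^2) / (sp * sq)"
    using pos by (simp add: divide_simps) algebra
  thus ?thesis
    using pos unfolding cos_at_apex_def cos_at_apex_t_def
    by (auto intro!: derivative_eq_intros edge_length_deriv_t[OF assms]
         simp: d[symmetric] power2_eq_square algebra_simps)
qed

lemma cos_at_apex_deriv_r:
  assumes "r \<noteq> 0"
  shows "((\<lambda>r. cos_at_apex p q t r) has_real_derivative cos_at_apex_r p q t r) (at r)"
proof -
  define Sp Cp Sq Cq sp sq where d: "Sp = sin (t/2 - p)" "Cp = cos (t/2 - p)"
    "Sq = sin (t/2 - q)" "Cq = cos (t/2 - q)" "sp = edge_length p t r" "sq = edge_length q t r"
  have pos: "sp > 0" "sq > 0"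
    using edge_length_pos[OF assms] by (simp_all add: d)
  have sq: "sp^2 = r^2 + 4 * Sp^2" "sq^2 = r^2 + 4 * Sq^2" "Sp^2 + Cp^2 = 1" "Sq^2 + Cq^2 = 1"
    by (simp_all add: d edge_length_squared)
  have cs: "cos (p - q) = Cq * Cp + Sq * Sp" "sin (p - q) = Sq * Cp - Cq * Sp"
    unfolding d by (rule cos_diff_half sin_diff_half)+
  have "2 * r * sp^2 * sq^2
      - (r^2 + 4 * Sp * Sq * cos (p - q)) * (r * sq^2 + r * sp^2)
      = 4 * r * sin (p - q) * (Sq * Cp * sp^2 - Sp * Cq * sq^2)"
    using sq(3,4) unfolding sq(1,2) cs by algebra
  hence "(2 * r * (sp * sq)
      - (r^2 + 4 * Sp * Sq * cos (p - q)) * (r / sp * sq + sp * (r / sq))) / (sp * sq)^2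
      = 4 * r * sin (p - q) * (Sq * Cp / sq^2 - Sp * Cq / sp^2) / (sp * sq)"
    using pos by (simp add: divide_simps) algebra
  thus ?thesis
    using pos unfolding cos_at_apex_def cos_at_apex_r_def
    by (auto intro!: derivative_eq_intros edge_length_deriv_r[OF assms]
         simp: d[symmetric] power2_eq_square algebra_simps)
qed

text \<open>Only the existence of second derivatives matters here and in the next two lemmas; their
  values are never computed.\<close>

lemma cos_at_apex_t_deriv_t:
  assumes "r \<noteq> 0"
  obtains d where "((\<lambda>t. cos_at_apex_t p q t r) has_real_derivative d) (at t)"
proof -
  have "\<exists>d. ((\<lambda>t. cos_at_apex_t p q t r) has_real_derivative d) (at t)"
    using edge_length_pos[OF assms, of p t] edge_length_pos[OF assms, of q t]
    unfolding cos_at_apex_t_def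
    by (intro exI) (rule derivative_eq_intros edge_length_deriv_t[OF assms] refl | simp)+
  thus ?thesis using that by blast
qed

lemma cos_at_apex_t_deriv_r:
  assumes "r \<noteq> 0"
  obtains d where "((\<lambda>r. cos_at_apex_t p q t r) has_real_derivative d) (at r)"
proof -
  have "\<exists>d. ((\<lambda>r. cos_at_apex_t p q t r) has_real_derivative d) (at r)"
    using edge_length_pos[OF assms, of p t] edge_length_pos[OF assms, of q t]
    unfolding cos_at_apex_t_def
    by (intro exI) (rule derivative_eq_intros edge_length_deriv_r[OF assms] refl | simp)+
  thus ?thesis using that by blast
qed

lemma cos_at_apex_r_deriv_r:
  assumes "r \<noteq> 0"
  obtains d where "((\<lambda>r. cos_at_apex_r p q t r) has_real_derivative d) (at r)"
proof -
  have "\<exists>d. ((\<lambda>r. cos_at_apex_r p q t r) has_real_derivative d) (at r)"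
    using edge_length_pos[OF assms, of p t] edge_length_pos[OF assms, of q t]
    unfolding cos_at_apex_r_def
    by (intro exI) (rule derivative_eq_intros edge_length_deriv_r[OF assms] refl | simp)+
  thus ?thesis using that by blast
qed

section \<open>The normal field and the second fundamental form\<close>

text \<open>A component of the normal; the constant \<open>k\<close> is the sine of the difference of the other two half
  angles.\<close>

definition conormal :: "real \<Rightarrow> real \<Rightarrow> real \<Rightarrow> real \<Rightarrow> real" where
  "conormal p k t r = cos (t/2 - p) / (k * edge_length p t r)"

text \<open>The two terms of the quotient rule combine through s^2 + 4 cos^2 (t/2 - p) = r^2 + 4.
  This factor is the same for all three vertices, so it can be pulled out of the cyclic sum.\<close>

lemma conormal_deriv_t:
  assumes "r \<noteq> 0" "k \<noteq> 0"
  shows "((\<lambda>t. conormal p k t r) has_real_derivative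
           - (r^2 + 4) * sin (t/2 - p) / (2 * k * edge_length p t r ^ 3)) (at t)"
proof -
  define S C s where d: "S = sin (t/2 - p)" "C = cos (t/2 - p)" "s = edge_length p t r"
  have s: "s > 0" using edge_length_pos[OF assms(1)] by (simp add: d)
  have sq: "s^2 = r^2 + 4 * S^2" "S^2 + C^2 = 1" by (simp_all add: d edge_length_squared)
  have "S * s^2 + 4 * S * C^2 = (r^2 + 4) * S"
    using sq by algebra
  hence "(- S / 2 * (k * s) - C * (k * (2 * S * C / s))) / (k * s * (k * s))
    = - (r^2 + 4) * S / (2 * k * s ^ 3)"
    using s assms(2) by (simp add: divide_simps) algebra
  thus ?thesis
    using s assms(2) unfolding conormal_def
    by (auto intro!: derivative_eq_intros edge_length_deriv_t[OF assms(1)] simp: d[symmetric] mult_ac)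
qed

lemma conormal_deriv_r:
  assumes "r \<noteq> 0" "k \<noteq> 0"
  shows "((\<lambda>r. conormal p k t r) has_real_derivative
           - r * cos (t/2 - p) / (k * edge_length p t r ^ 3)) (at r)"
proof -
  define s where d: "s = edge_length p t r"
  have s: "s > 0" using edge_length_pos[OF assms(1)] by (simp add: d)
  show ?thesis
    using s assms(2) unfolding conormal_def
    by (auto intro!: derivative_eq_intros edge_length_deriv_r[OF assms(1)]
        simp: d[symmetric] divide_simps power3_eq_cube)
qed

text \<open>These are the two diagonal coefficients up to positive factors. The height drops out of
  both: in the first the weights enter as differences, and in the second the coefficient of r^2 is
  the cyclic sum of cos x sin (z - y), which is 0. What remains is the same trigonometric
  polynomial.\<close>

lemma weighted_cyclic_sum:
  fixes x y z r :: real
  defines "w \<equiv> \<lambda>x. r^2 + 4 * (sin x)^2"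
    and "V \<equiv> sin (x - y) * sin (y - z) * sin (z - x) * cos (x + y + z)"
  shows "sin x * cos y * cos z * (w z - w y) + sin y * cos z * cos x * (w x - w z)
      + sin z * cos x * cos y * (w y - w x) = - 4 * V"
    and "cos x * (sin z * cos y * w y - sin y * cos z * w z)
      + cos y * (sin x * cos z * w z - sin z * cos x * w x)
      + cos z * (sin y * cos x * w x - sin x * cos y * w y) = - 4 * V"
proof -
  have V: "V = (sin x * cos y - cos x * sin y) * (sin y * cos z - cos y * sin z)
      * (sin z * cos x - cos z * sin x)
      * ((cos x * cos y - sin x * sin y) * cos z - (sin x * cos y + cos x * sin y) * sin z)"
    by (simp add: V_def sin_diff cos_add sin_add)
  have sq: "(sin x)^2 + (cos x)^2 = 1" "(sin y)^2 + (cos y)^2 = 1" "(sin z)^2 + (cos z)^2 = 1"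
    by simp_all
  show "sin x * cos y * cos z * (w z - w y) + sin y * cos z * cos x * (w x - w z)
      + sin z * cos x * cos y * (w y - w x) = - 4 * V"
    using sq unfolding V w_def by algebra
  show "cos x * (sin z * cos y * w y - sin y * cos z * w z)
      + cos y * (sin x * cos z * w z - sin z * cos x * w x)
      + cos z * (sin y * cos x * w x - sin x * cos y * w y) = - 4 * V"
    using sq unfolding V w_def by algebra
qed

text \<open>One component of each inner product, put over a denominator symmetric in the three
  vertices. Summed cyclically, the first three forms telescope to 0 and the last two become the sums
  of \<open>weighted_cyclic_sum\<close>.\<close>

lemma tangent_conormal_products:
  fixes m p q t r D :: real
  assumes r: "r \<noteq> 0" and k: "sin (p - q) \<noteq> 0"
    and D: "D = edge_length m t r * edge_length p t r * edge_length q t r"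
  shows "cos_at_apex_t p q t r * conormal m (sin (p - q)) t r
      = 2 * r^2 * cos (t/2 - m) * cos (t/2 - p) * cos (t/2 - q) / D
        * (1 / (edge_length p t r)^2 - 1 / (edge_length q t r)^2)" (is ?thesis1)
    and "cos_at_apex_r p q t r * conormal m (sin (p - q)) t r
      = 4 * r / D * (cos (t/2 - m) * cos (t/2 - p) * sin (t/2 - q) / (edge_length q t r)^2
          - cos (t/2 - m) * sin (t/2 - p) * cos (t/2 - q) / (edge_length p t r)^2)" (is ?thesis2)
    and "cos_at_apex_t p q t r * (- r * cos (t/2 - m) / (sin (p - q) * edge_length m t r ^ 3))
      = - 2 * r^3 * cos (t/2 - m) * cos (t/2 - p) * cos (t/2 - q) / D^3
        * ((edge_length q t r)^2 - (edge_length p t r)^2)" (is ?thesis3)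
    and "cos_at_apex_t p q t r
        * (- (r^2 + 4) * sin (t/2 - m) / (2 * sin (p - q) * edge_length m t r ^ 3))
      = - (r^2 * (r^2 + 4)) / D^3 * (sin (t/2 - m) * cos (t/2 - p) * cos (t/2 - q)
          * ((edge_length q t r)^2 - (edge_length p t r)^2))" (is ?thesis4)
    and "cos_at_apex_r p q t r * (- r * cos (t/2 - m) / (sin (p - q) * edge_length m t r ^ 3))
      = - (4 * r^2) / D^3 * (cos (t/2 - m)
          * (sin (t/2 - q) * cos (t/2 - p) * (edge_length p t r)^2
            - sin (t/2 - p) * cos (t/2 - q) * (edge_length q t r)^2))" (is ?thesis5)
proof -
  define Sm Cm Sp Cp Sq Cq sm sp sq k where d: "Sm = sin (t/2 - m)" "Cm = cos (t/2 - m)"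
    "Sp = sin (t/2 - p)" "Cp = cos (t/2 - p)" "Sq = sin (t/2 - q)" "Cq = cos (t/2 - q)"
    "sm = edge_length m t r" "sp = edge_length p t r" "sq = edge_length q t r" "k = sin (p - q)"
  have nz: "sm \<noteq> 0" "sp \<noteq> 0" "sq \<noteq> 0" "k \<noteq> 0"
    using edge_length_pos[OF r, of m t] edge_length_pos[OF r, of p t] edge_length_pos[OF r, of q t] k
    by (simp_all add: d)
  show ?thesis1 ?thesis2 ?thesis3 ?thesis4 ?thesis5
    unfolding cos_at_apex_t_def cos_at_apex_r_def conormal_def D d[symmetric]
    using nz by (simp_all add: field_simps power2_eq_square power3_eq_cube)
qed

lemma cylinder_image_curvature_pos:
  assumes "r > 0" "sin (a - b) \<noteq> 0" "sin (b - c) \<noteq> 0" "sin (c - a) \<noteq> 0"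
    and "cos (3 * t / 2 - a - b - c) \<noteq> 0"
  shows "gaussian_curvature (\<lambda>t r. vector [cos_at_apex b c t r, cos_at_apex c a t r, cos_at_apex a b t r]) t r > 0"
proof -
  note nz = assms(2-4)
  let ?n = "\<lambda>t r. vector [conormal a (sin (b - c)) t r, conormal b (sin (c - a)) t r,
     conormal c (sin (a - b)) t r] :: real^3"
  let ?Xt = "\<lambda>t r. vector [cos_at_apex_t b c t r, cos_at_apex_t c a t r, cos_at_apex_t a b t r] :: real^3"
  let ?Xr = "\<lambda>t r. vector [cos_at_apex_r b c t r, cos_at_apex_r c a t r, cos_at_apex_r a b t r] :: real^3"
  let ?nt = "vector [- (r^2 + 4) * sin (t/2 - a) / (2 * sin (b - c) * edge_length a t r ^ 3),
     - (r^2 + 4) * sin (t/2 - b) / (2 * sin (c - a) * edge_length b t r ^ 3),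
     - (r^2 + 4) * sin (t/2 - c) / (2 * sin (a - b) * edge_length c t r ^ 3)] :: real^3"
  let ?nr = "vector [- r * cos (t/2 - a) / (sin (b - c) * edge_length a t r ^ 3),
     - r * cos (t/2 - b) / (sin (c - a) * edge_length b t r ^ 3),
     - r * cos (t/2 - c) / (sin (a - b) * edge_length c t r ^ 3)] :: real^3"
  have r: "r \<noteq> 0" using assms(1) by simp
  obtain d1 d2 d3 where tt:
    "((\<lambda>t. cos_at_apex_t b c t r) has_real_derivative d1) (at t)"
    "((\<lambda>t. cos_at_apex_t c a t r) has_real_derivative d2) (at t)"
    "((\<lambda>t. cos_at_apex_t a b t r) has_real_derivative d3) (at t)"
    using cos_at_apex_t_deriv_t[OF r] by metis
  obtain e1 e2 e3 where tr:
    "((\<lambda>r. cos_at_apex_t b c t r) has_real_derivative e1) (at r)"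
    "((\<lambda>r. cos_at_apex_t c a t r) has_real_derivative e2) (at r)"
    "((\<lambda>r. cos_at_apex_t a b t r) has_real_derivative e3) (at r)"
    using cos_at_apex_t_deriv_r[OF r] by metis
  obtain f1 f2 f3 where rr:
    "((\<lambda>r. cos_at_apex_r b c t r) has_real_derivative f1) (at r)"
    "((\<lambda>r. cos_at_apex_r c a t r) has_real_derivative f2) (at r)"
    "((\<lambda>r. cos_at_apex_r a b t r) has_real_derivative f3) (at r)"
    using cos_at_apex_r_deriv_r[OF r] by metis
  show ?thesis
  proof (rule gaussian_curvature_pos_of_conormal[where T = "{0<..}" and Xs = ?Xt and Xt = ?Xr and n = ?n
        and ns = ?nt and nt = ?nr])
    fix t r :: real assume "r \<in> {0<..}"
    hence r: "r \<noteq> 0" by simp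
    show "((\<lambda>t. vector [cos_at_apex b c t r, cos_at_apex c a t r, cos_at_apex a b t r])
      has_vector_derivative ?Xt t r) (at t)"
      by (intro vector_3_has_vector_derivative cos_at_apex_deriv_t r)
    show "((\<lambda>r. vector [cos_at_apex b c t r, cos_at_apex c a t r, cos_at_apex a b t r])
      has_vector_derivative ?Xr t r) (at r)"
      by (intro vector_3_has_vector_derivative cos_at_apex_deriv_r r)
    define D where "D = edge_length a t r * edge_length b t r * edge_length c t r"
    note products = tangent_conormal_products[OF r]
    have D: "D = edge_length a t r * edge_length b t r * edge_length c t r"
      "D = edge_length b t r * edge_length c t r * edge_length a t r"
      "D = edge_length c t r * edge_length a t r * edge_length b t r"
      by (simp_all add: D_def)
    show "?Xt t r \<bullet> ?n t r = 0"
      unfolding inner_vector_3 products(1)[OF nz(2) D(1)] products(1)[OF nz(3) D(2)]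
        products(1)[OF nz(1) D(3)] by (simp add: algebra_simps add_divide_distrib diff_divide_distrib)
    show "?Xr t r \<bullet> ?n t r = 0"
      unfolding inner_vector_3 products(2)[OF nz(2) D(1)] products(2)[OF nz(3) D(2)]
        products(2)[OF nz(1) D(3)] by (simp add: algebra_simps add_divide_distrib diff_divide_distrib)
  next
    define D where "D = edge_length a t r * edge_length b t r * edge_length c t r"
    note products = tangent_conormal_products[OF r]
    have D: "D = edge_length a t r * edge_length b t r * edge_length c t r"
      "D = edge_length b t r * edge_length c t r * edge_length a t r"
      "D = edge_length c t r * edge_length a t r * edge_length b t r"
      by (simp_all add: D_def)
    have "D > 0" using edge_length_pos[OF r] by (simp add: D_def)
    define V where "V = sin (b - a) * sin (c - b) * sin (a - c) * cos (3 * t / 2 - a - b - c)"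
    have V: "V = sin ((t/2 - a) - (t/2 - b)) * sin ((t/2 - b) - (t/2 - c)) * sin ((t/2 - c) - (t/2 - a))
        * cos ((t/2 - a) + (t/2 - b) + (t/2 - c))"
      by (simp add: V_def algebra_simps)
    have "sin (b - a) \<noteq> 0" "sin (c - b) \<noteq> 0" "sin (a - c) \<noteq> 0"
      using nz sin_minus[of "a - b"] sin_minus[of "b - c"] sin_minus[of "c - a"] by auto
    hence "V \<noteq> 0" using assms(5) by (simp add: V_def)
    \<comment> \<open>A common product of three cosines multiplies cyclic differences of squared
      lengths, so the sum vanishes: the two families of parameter lines are conjugate.\<close>
    show "?Xt t r \<bullet> ?nr = 0"
      unfolding inner_vector_3 products(3)[OF nz(2) D(1)] products(3)[OF nz(3) D(2)]
        products(3)[OF nz(1) D(3)] by (simp add: algebra_simps add_divide_distrib diff_divide_distrib)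
    have tt_eq: "?Xt t r \<bullet> ?nt = - (r^2 * (r^2 + 4)) / D^3 * (- 4 * V)"
      unfolding V weighted_cyclic_sum(1)[symmetric, where r = r] edge_length_squared[symmetric]
        inner_vector_3 products(4)[OF nz(2) D(1)] products(4)[OF nz(3) D(2)]
        products(4)[OF nz(1) D(3)] by (simp only: distrib_left)
    have rr_eq: "?Xr t r \<bullet> ?nr = - (4 * r^2) / D^3 * (- 4 * V)"
      unfolding V weighted_cyclic_sum(2)[symmetric, where r = r] edge_length_squared[symmetric]
        inner_vector_3 products(5)[OF nz(2) D(1)] products(5)[OF nz(3) D(2)]
        products(5)[OF nz(1) D(3)] by (simp only: distrib_left)
    \<comment> \<open>\<open>V\<close> enters squared, so its sign, which varies with the
      orientation of the triangle and with \<open>t\<close>, does not affect the result.\<close>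
    have "(?Xt t r \<bullet> ?nt) * (?Xr t r \<bullet> ?nr) = 64 * r^4 * (r^2 + 4) * V^2 / D^6"
      unfolding tt_eq rr_eq using \<open>D > 0\<close> by (simp add: field_simps eval_nat_numeral)
    also have "\<dots> > 0"
      using \<open>V \<noteq> 0\<close> \<open>D > 0\<close> r by (simp add: add_nonneg_pos)
    finally show "(?Xt t r \<bullet> ?nt) * (?Xr t r \<bullet> ?nr) > 0" .
    show "((\<lambda>t. ?Xt t r) has_vector_derivative vector [d1, d2, d3]) (at t)"
      by (rule vector_3_has_vector_derivative[OF tt])
    show "((\<lambda>r. ?Xt t r) has_vector_derivative vector [e1, e2, e3]) (at r)"
      by (rule vector_3_has_vector_derivative[OF tr])
    show "((\<lambda>r. ?Xr t r) has_vector_derivative vector [f1, f2, f3]) (at r)"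
      by (rule vector_3_has_vector_derivative[OF rr])
    show "((\<lambda>t. ?n t r) has_vector_derivative ?nt) (at t)"
      by (intro vector_3_has_vector_derivative conormal_deriv_t r nz)
    show "((\<lambda>r. ?n t r) has_vector_derivative ?nr) (at r)"
      by (intro vector_3_has_vector_derivative conormal_deriv_r r nz)
  qed (use assms(1) in auto)
qed

section \<open>The surface in half-angle coordinates\<close>

abbreviation circle_point :: "real \<Rightarrow> real^3" where
  "circle_point p \<equiv> vector [cos (2 * p), sin (2 * p), 0]"

text \<open>The horizontal parts are chords from a common endpoint, with signed lengths 2 sin (t/2 -
  p) and 2 sin (t/2 - q) and inscribed angle p - q. The vertical parts contribute r^2.\<close>

lemma inner_edges:
  "(circle_point p - cyl_point t r) \<bullet> (circle_point q - cyl_point t r)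
     = r^2 + 4 * sin (t/2 - p) * sin (t/2 - q) * cos (p - q)"
proof -
  have diff: "circle_point p - cyl_point t r = vector [cos (2*p) - cos (2*(t/2)), sin (2*p) - sin (2*(t/2)), - r]" for p
    by (simp add: cyl_point_def vec_eq_iff forall_3)
  have sq: "(sin p)^2 + (cos p)^2 = 1" "(sin q)^2 + (cos q)^2 = 1" "(sin (t/2))^2 + (cos (t/2))^2 = 1"
    by simp_all
  show ?thesis
    using sq unfolding diff unfolding inner_vector_3 cos_double sin_double sin_diff cos_diff by algebra
qed

lemma norm_edge: "norm (circle_point p - cyl_point t r) = edge_length p t r"
  by (simp add: norm_eq_sqrt_inner inner_edges edge_length_def power2_eq_square)

text \<open>Cauchy-Schwarz keeps the argument of \<open>arccos\<close> in [-1, 1]. When the apex is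
  a vertex of the triangle, the quotient has denominator 0 and equals 0 on both sides, so the
  identity holds as one of functions.\<close>

lemma cos_angle_cyl_point:
  "cos (angle (circle_point p) (cyl_point t r) (circle_point q)) = cos_at_apex p q t r"
proof -
  have "\<bar>(circle_point p - cyl_point t r) \<bullet> (circle_point q - cyl_point t r)\<bar>
    \<le> norm (circle_point p - cyl_point t r) * norm (circle_point q - cyl_point t r)"
    by (rule Cauchy_Schwarz_ineq2)
  moreover have "\<bar>x / y\<bar> \<le> 1" if "\<bar>x\<bar> \<le> y" for x y :: real
  proof (cases "y = 0")
    case False
    hence "y > 0" using that by linarith
    thus ?thesis using that by (simp add: abs_divide)
  qed simp
  ultimately have "\<bar>cos_at_apex p q t r\<bar> \<le> 1"
    unfolding inner_edges norm_edge cos_at_apex_def by blast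
  thus ?thesis
    unfolding angle_def inner_edges norm_edge cos_at_apex_def[symmetric] by (simp add: cos_arccos_abs)
qed

lemma FC_circle_points:
  "FC (circle_point a) (circle_point b) (circle_point c) =
     (\<lambda>t r. vector [cos_at_apex b c t r, cos_at_apex c a t r, cos_at_apex a b t r])"
proof -
  \<comment> \<open>The symmetric swap gives the cyclic order (b, c), (c, a), (a, b) that matches
    the signs of the normal's constants.\<close>
  have "cos_at_apex a c = cos_at_apex c a"
    by (simp add: fun_eq_iff cos_at_apex_def mult_ac cos_diff)
  thus ?thesis
    by (simp add: fun_eq_iff FC_def F_def cos_angle_cyl_point)
qed

text \<open>The parameter is u = cot b, and the rational parametrization is the pair of double-angle
  formulas. The remaining vertex A has half angle 0, where the cotangent is infinite.\<close>

lemma half_angle_param: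
  fixes u :: real
  obtains b where "sin b > 0" "cos b = u * sin b"
    "(u^2 - 1) / (u^2 + 1) = cos (2 * b)" "2 * u / (u^2 + 1) = sin (2 * b)"
proof -
  define s where "s = 1 / sqrt (u^2 + 1)"
  have pos: "u^2 + 1 > 0" by (simp add: add_nonneg_pos)
  hence s: "s > 0" "s^2 * (u^2 + 1) = 1" by (simp_all add: s_def power_divide)
  hence "(u * s)^2 + s^2 = 1" by (simp add: algebra_simps)
  then obtain b where b: "u * s = cos b" "s = sin b" using sincos_total_2pi by metis
  have eq: "(sin b)^2 * (u^2 + 1) = 1" "cos b = u * sin b" using s b by simp_all
  show ?thesis
  proof
    show "sin b > 0" "cos b = u * sin b" using s b by simp_all
    have "(u^2 - 1) / (u^2 + 1) = (u^2 - 1) * ((sin b)^2 * (u^2 + 1)) / (u^2 + 1)"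
      by (simp add: eq)
    also have "\<dots> = (u^2 - 1) * (sin b)^2" using pos by simp
    finally show "(u^2 - 1) / (u^2 + 1) = cos (2 * b)"
      unfolding cos_double eq(2) by (simp add: algebra_simps)
    have "2 * u / (u^2 + 1) = 2 * u * ((sin b)^2 * (u^2 + 1)) / (u^2 + 1)"
      by (simp add: eq)
    also have "\<dots> = 2 * u * (sin b)^2" using pos by simp
    finally show "2 * u / (u^2 + 1) = sin (2 * b)"
      unfolding sin_double eq(2) by (simp add: power2_eq_square)
  qed
qed

section \<open>The singular angles and the conclusion\<close>

text \<open>With u = cot b and v = cot c, the cosine is a nonzero multiple of (u v - 1) cos 3x + (u
  + v) sin 3x for x = \<theta>/2. The triple-angle formulas turn this into -cos^3 x times the cubic
  in tan x.\<close>

lemma regular_angle_cos_nonzero: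
  assumes "\<theta> \<in> {0..<2*pi} - singular_angles u v"
    and b: "sin b > 0" "cos b = u * sin b" and c: "sin c > 0" "cos c = v * sin c"
  shows "cos (3 * \<theta> / 2 - b - c) \<noteq> 0"
proof -
  define x where "x = \<theta> / 2"
  have "cos (3 * \<theta> / 2 - b - c) = cos (3 * x) * cos (b + c) + sin (3 * x) * sin (b + c)"
    using cos_diff[of "3 * x" "b + c"] by (simp add: x_def algebra_simps)
  also have "\<dots> = sin b * sin c * (cos (3 * x) * (u * v - 1) + sin (3 * x) * (u + v))"
    unfolding cos_add sin_add b(2) c(2) by algebra
  finally have eq: "cos (3 * \<theta> / 2 - b - c) =
    sin b * sin c * (cos (3 * x) * (u * v - 1) + sin (3 * x) * (u + v))" .
  show ?thesis
  proof (cases "\<theta> = pi")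
    case True
    \<comment> \<open>At 3x = 3 pi/2 only the term -(u + v) survives, which is the root at infinity
      of the cubic.\<close>
    hence "cos (3 * x) = cos (pi / 2 + pi)" "sin (3 * x) = sin (pi / 2 + pi)"
      by (simp_all add: x_def)
    hence "cos (3 * x) = 0" "sin (3 * x) = -1"
      by (simp_all only: cos_add sin_add) simp_all
    moreover have "u + v \<noteq> 0"
      using assms(1) True by (auto simp: singular_angles_def)
    ultimately show ?thesis unfolding eq using b(1) c(1) by simp
  next
    case False
    have "cos x \<noteq> 0"
    proof
      assume "cos x = 0"
      moreover have "0 \<le> x" "x \<le> pi"
        using assms(1) by (simp_all add: x_def)
      ultimately have "x = pi / 2"
        using cos_inj_pi[of x "pi / 2"] pi_ge_zero cos_pi_half by linarith
      thus False using False by (simp add: x_def)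
    qed
    define t where "t = tan x"
    have t: "sin x = t * cos x" using \<open>cos x \<noteq> 0\<close> by (simp add: t_def tan_def)
    define Q where "Q = (u + v) * t^3 + 3 * (u * v - 1) * t^2 - 3 * (u + v) * t - u * v + 1"
    have "Q \<noteq> 0"
      using assms(1) False unfolding Q_def singular_angles_def t_def x_def Let_def by simp
    have c3: "cos (3 * x) = cos x * ((cos x)^2 - (sin x)^2) - sin x * (2 * sin x * cos x)"
      and s3: "sin (3 * x) = sin x * ((cos x)^2 - (sin x)^2) + cos x * (2 * sin x * cos x)"
      using cos_add[of x "2 * x"] sin_add[of x "2 * x"] by (simp_all add: cos_double sin_double)
    have "cos (3 * x) * (u * v - 1) + sin (3 * x) * (u + v) =
      - ((cos x)^3 * Q)"
      unfolding c3 s3 t Q_def by algebra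
    thus ?thesis unfolding eq using \<open>Q \<noteq> 0\<close> b(1) c(1) \<open>cos x \<noteq> 0\<close> by simp
  qed
qed

text \<open>Membership of the point fixes the angle only modulo 2 pi. A shift by 2 pi n changes 3
  \<theta>/2 by 3 pi n, which at most flips the sign of the cosine.\<close>

lemma M_reg_cos_nonzero:
  assumes "cyl_point \<theta> r \<in> M_reg u v"
    and "sin b > 0" "cos b = u * sin b" "sin c > 0" "cos c = v * sin c"
  shows "r > 0" "cos (3 * \<theta> / 2 - b - c) \<noteq> 0"
proof -
  obtain \<phi> where \<phi>: "\<phi> \<in> {0..<2*pi} - singular_angles u v" "r > 0"
    "cos \<theta> = cos \<phi>" "sin \<theta> = sin \<phi>"
    using assms(1) by (auto simp: M_reg_def cyl_point_def vec_eq_iff forall_3)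
  show "r > 0" by fact
  obtain n :: int where n: "\<theta> = \<phi> + 2 * pi * n"
    using \<phi>(3,4) sin_cos_eq_iff by metis
  have "3 * \<theta> / 2 - b - c = (3 * \<phi> / 2 - b - c) + pi * of_int (3 * n)"
    unfolding n by (simp add: field_simps)
  hence "cos (3 * \<theta> / 2 - b - c) = cos (3 * \<phi> / 2 - b - c) * cos (pi * of_int (3 * n))"
    by (simp only: cos_add sin_npi_int mult_zero_right diff_zero)
  thus "cos (3 * \<theta> / 2 - b - c) \<noteq> 0"
    using regular_angle_cos_nonzero[OF \<phi>(1) assms(2-5)] by (simp only: cos_npi_int) simp
qed

theorem proposition17:
  fixes u v :: real and A B C :: "real^3"
  assumes "u \<noteq> v"
    and "A = vector [1, 0, 0]"
    and "B = vector [(u^2 - 1) / (u^2 + 1), 2 * u / (u^2 + 1), 0]"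
    and "C = vector [(v^2 - 1) / (v^2 + 1), 2 * v / (v^2 + 1), 0]"
  shows "\<forall>\<theta> r. cyl_point \<theta> r \<in> M_reg u v \<longrightarrow> gaussian_curvature (FC A B C) \<theta> r > 0"
proof (intro allI impI)
  fix \<theta> r assume reg: "cyl_point \<theta> r \<in> M_reg u v"
  obtain b where b: "sin b > 0" "cos b = u * sin b"
    "(u^2 - 1) / (u^2 + 1) = cos (2 * b)" "2 * u / (u^2 + 1) = sin (2 * b)"
    by (rule half_angle_param)
  obtain c where c: "sin c > 0" "cos c = v * sin c"
    "(v^2 - 1) / (v^2 + 1) = cos (2 * c)" "2 * v / (v^2 + 1) = sin (2 * c)"
    by (rule half_angle_param)
  \<comment> \<open>The difference of cotangents: distinct parameters u and v give distinct half
    angles modulo pi. The other two sines are nonzero because A has half angle 0 and sin b, sin c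
    are positive.\<close>
  have "sin (b - c) = sin b * sin c * (v - u)"
    by (simp add: sin_diff b(2) c(2) algebra_simps)
  hence "sin (b - c) \<noteq> 0" using b(1) c(1) assms(1) by simp
  hence "gaussian_curvature (FC (circle_point 0) (circle_point b) (circle_point c)) \<theta> r > 0"
    unfolding FC_circle_points
    using M_reg_cos_nonzero[OF reg b(1,2) c(1,2)] b(1) c(1)
    by (intro cylinder_image_curvature_pos) simp_all
  moreover have "A = circle_point 0" "B = circle_point b" "C = circle_point c"
    unfolding assms(2-4) b(3,4) c(3,4) by simp_all
  ultimately show "gaussian_curvature (FC A B C) \<theta> r > 0"
    by (simp only:)
qed

end
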